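(* Let $\gamma>0$ and let $\vec x^\star\in\mathcal C$ be such that $F(\vec x^\star)=\vec 0$. Suppose that all matrices in the set $\hat J\mathcal R_\gamma(\vec x^\star)$ are nonsingular. Then there exists $\varepsilon>0$ such that, for every starting point $\vec x^0\in \mathrm{B}(\vec x^\star,\varepsilon)$, the iterations $$\vec x^{k+1}=\vec x^k+\vec d^k,\qquad\text{where}\quad \hat{\mathbf H}_k\vec d^k=-\mathcal R_\gamma(\vec x^k),\qquad k=0,1,2,\dots,$$ with $\hat{\mathbf H}_k$ being any element of $\hat J\mathcal R_\gamma(\vec x^k)$, are $Q$-quadratically convergent to $\vec x^\star$.
   Context: **Problem.** Fix positive integers $N,R,I_1,\dots,I_N$ and a real tensor $\mathcal T\in\mathbb R^{I_1\times\cdots\times I_N}$. Let $d=R\sum_{n=1}^N I_n$. The variable is $\vec x=(\vec a,\vec\lambda)\in\mathbb R^d\times\mathbb R^R$, where $\vec a$ is the concatenation of vectors $\vec a_r^{(n)}\in\mathbb R^{I_n}$ ($n=1,\dots,N$, $r=1,\dots,R$) and $\vec\lambda=(\lambda_1,\dots,\lambda_R)$. Define $$F(\vec a,\vec\lambda)=\sum_{r=1}^R\lambda_r\,\vec a_r^{(1)}\otimes\cdots\otimes\vec a_r^{(N)}-\mathcal T$$ (outer products), regarded as a vector in $\mathbb R^{I_1\cdots I_N}$. $JF(\vec x)$ is its Jacobian matrix. The feasible set is $$\mathcal C=\{(\vec a,\vec\lambda)\in\mathbb R^d\times\mathbb R^R : \vec a\ge 0,\ \vec\lambda\ge 0,\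 \|\vec a_r^{(n)}\|=1\ \text{for all } n,r\},$$ with inequalities elementwise and Euclidean norms. The constrained problem is to minimize $\tfrac12\|F(\vec x)\|^2$ over $\vec x\in\mathcal C$. **Projection.** $\Pi_{\mathcal C}$ is the Euclidean projection onto $\mathcal C$. Write $[\cdot]_+=\max\{0,\cdot\}$ elementwise. For $\vec w=((\vec w_r^{(n)})_{n,r},\vec w_\lambda)$ such that $[\vec w_r^{(n)}]_+\ne \vec 0$ for all $n,r$, $\Pi_{\mathcal C}(\vec w)$ is single-valued, with vector blocks $[\vec w_r^{(n)}]_+/\|[\vec w_r^{(n)}]_+\|$ and last block $[\vec w_\lambda]_+$. **Generalized Jacobian of the projection.** For such $\vec w$, $J\Pi_{\mathcal C}(\vec w)$ denotes the set of all block-diagonal $(d+R)\times(d+R)$ matrices whose $(n,r)$ block is $$\frac{\mathbf I-\vec z\vec z^\top}{\|[\vec w_r^{(n)}]_+\|}\,\mathbf D_r^{(n)},\qquad \vec z=\frac{[\vec w_r^{(n)}]_+}{\|[\vec w_r^{(n)}]_+\|},$$ and whose last block is $\mathbf D_\lambda$. Here $\mathbf D_r^{(n)}$ (resp. $\mathbf D_\lambda$) is any diagonal matrix whose $i$-th diagonal entry equals $1$ if the $i$-th entry of $\vec w_r^{(n)}$ (resp. $\vec w_\lambda$) is positive, is an arbitrary number in $[0,1]$ if that entry is zero, and equals $0$ if it is negative. **Residual and its approximate Jacobian.** For $\gamma>0$ and $\vec w=\vec x-\gamma JF(\vec x)^\top F(\vec x)$, $$\mathcal R_\gamma(\vec x)=\vec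 x-\Pi_{\mathcal C}(\vec w),\qquad \hat J\mathcal R_\gamma(\vec x)=\{\mathbf I-\mathbf P[\mathbf I-\gamma JF(\vec x)^\top JF(\vec x)] : \mathbf P\in J\Pi_{\mathcal C}(\vec w)\}.$$ These are well defined in a neighborhood of any $\vec x^\star\in\mathcal C$ with $F(\vec x^\star)=\vec 0$. $\mathrm B(\vec x,\varepsilon)$ is the ball of radius $\varepsilon$ around $\vec x$. $Q$-quadratic convergence to $\vec x^\star$ means $\vec x^k\to\vec x^\star$ and there is $c\ge0$ with $\|\vec x^{k+1}-\vec x^\star\|\le c\|\vec x^k-\vec x^\star\|^2$ for all large $k$. *)

theory Defs
  imports "HOL-Analysis.Analysis"
begin

text \<open>
  Index conventions. The type \<open>'n\<close> indexes the modes (\<open>N = CARD('n)\<close>) and \<open>'r\<close> the rank-one terms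
  (\<open>R = CARD('r)\<close>). Since the mode sizes \<open>I\<^sub>n\<close> vary with the mode, the index sets of all modes are put
  together into one type \<open>'i\<close>, their disjoint union, and \<open>mode :: 'i \<Rightarrow> 'n\<close> tells to which mode an
  index belongs; thus \<open>I\<^sub>n = card {i. mode i = n}\<close>, and \<open>surj mode\<close> says that all \<open>I\<^sub>n\<close> are positive.

  A tensor entry is addressed by a multi-index, i.e. a choice of one index in each mode. The type \<open>'m\<close>
  enumerates the multi-indices: \<open>idx m n\<close> is the component of \<open>m\<close> in mode \<open>n\<close>, so that \<open>real ^ 'm\<close> is
  the space of real tensors of size \<open>I\<^sub>1 \<times> \<dots> \<times> I\<^sub>N\<close>.
\<close>

definition tensor_shape :: "('i::finite \<Rightarrow> 'n::finite) \<Rightarrow> ('m::finite \<Rightarrow> 'n \<Rightarrow> 'i) \<Rightarrow> bool" where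
  "tensor_shape mode idx \<longleftrightarrow>
     surj mode \<and> bij_betw idx UNIV {j. \<forall>n. mode (j n) = n}"

lemma tensor_shape_card:
  fixes mode :: "'i::finite \<Rightarrow> 'n::finite" and idx :: "'m::finite \<Rightarrow> 'n \<Rightarrow> 'i"
  assumes "tensor_shape mode idx"
  shows "CARD('m) = (\<Prod>n\<in>UNIV. card {i. mode i = n})"
    and "CARD('i) = (\<Sum>n\<in>UNIV. card {i. mode i = n})"
proof -
  have "{j. \<forall>n. mode (j n) = n} = (\<Pi>\<^sub>E n\<in>UNIV. {i. mode i = n})"
    by (auto simp: PiE_def Pi_def)
  then show "CARD('m) = (\<Prod>n\<in>UNIV. card {i. mode i = n})"
    using assms bij_betw_same_card[of idx UNIV "{j. \<forall>n. mode (j n) = n}"]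
    by (simp add: tensor_shape_def card_PiE)
  have "(UNIV :: 'i set) = (\<Union>n. {i. mode i = n})"
    by auto
  then show "CARD('i) = (\<Sum>n\<in>UNIV. card {i. mode i = n})"
    using card_UN_disjoint[of "UNIV :: 'n set" "\<lambda>n. {i. mode i = n}"] by auto
qed

text \<open>
  The variable \<open>x = (a, \<lambda>)\<close> is a vector indexed by \<open>'i \<times> 'r + 'r\<close>: the coordinate \<open>Inl (i, r)\<close> is the
  entry with index \<open>i\<close> of the vector \<open>a\<^sub>r\<^sup>(\<^sup>n\<^sup>)\<close>, where \<open>n = mode i\<close>, and the coordinate \<open>Inr r\<close> is \<open>\<lambda>\<^sub>r\<close>.
\<close>

definition F :: "('m::finite \<Rightarrow> 'n::finite \<Rightarrow> 'i::finite) \<Rightarrow> real ^ 'm \<Rightarrow> real ^ ('i \<times> 'r::finite + 'r) \<Rightarrow> real ^ 'm" where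
  "F idx T x = (\<chi> m. (\<Sum>r\<in>UNIV. x $ Inr r * (\<Prod>n\<in>UNIV. x $ Inl (idx m n, r)))) - T"

definition JF :: "('m::finite \<Rightarrow> 'n::finite \<Rightarrow> 'i::finite) \<Rightarrow> real ^ 'm \<Rightarrow> real ^ ('i \<times> 'r::finite + 'r)
    \<Rightarrow> real ^ ('i \<times> 'r + 'r) ^ 'm" where
  "JF idx T x = jacobian (F idx T) (at x)"

definition block_norm :: "('i::finite \<Rightarrow> 'n::finite) \<Rightarrow> real ^ ('i \<times> 'r::finite + 'r) \<Rightarrow> 'n \<Rightarrow> 'r \<Rightarrow> real" where
  "block_norm mode x n r = L2_set (\<lambda>i. x $ Inl (i, r)) {i. mode i = n}"

definition feasible_set :: "('i::finite \<Rightarrow> 'n::finite) \<Rightarrow> (real ^ ('i \<times> 'r::finite + 'r)) set" where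
  "feasible_set mode = {x. (\<forall>c. 0 \<le> x $ c) \<and> (\<forall>n r. block_norm mode x n r = 1)}"

definition pos_part :: "real ^ 'c \<Rightarrow> real ^ 'c" where
  "pos_part w = (\<chi> c. max 0 (w $ c))"

definition proj_regular :: "('i::finite \<Rightarrow> 'n::finite) \<Rightarrow> real ^ ('i \<times> 'r::finite + 'r) \<Rightarrow> bool" where
  "proj_regular mode w \<longleftrightarrow> (\<forall>n r. \<exists>i. mode i = n \<and> pos_part w $ Inl (i, r) \<noteq> 0)"

definition sign_diag :: "real ^ 'c \<Rightarrow> real ^ 'c \<Rightarrow> bool" where
  "sign_diag w D \<longleftrightarrow> (\<forall>c. (w $ c > 0 \<longrightarrow> D $ c = 1) \<and>
                           (w $ c = 0 \<longrightarrow> 0 \<le> D $ c \<and> D $ c \<le> 1) \<and>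
                           (w $ c < 0 \<longrightarrow> D $ c = 0))"

text \<open>
  The block-diagonal matrix with the blocks \<open>(I - z z\<^sup>T) / \<parallel>[w\<^sub>r\<^sup>(\<^sup>n\<^sup>)]\<^sub>+\<parallel> * D\<^sub>r\<^sup>(\<^sup>n\<^sup>)\<close> and \<open>D\<^sub>\<lambda>\<close>, where the
  vector \<open>D\<close> collects the diagonals of all the matrices \<open>D\<^sub>r\<^sup>(\<^sup>n\<^sup>)\<close> and \<open>D\<^sub>\<lambda>\<close>.
\<close>

definition proj_jac_matrix :: "('i::finite \<Rightarrow> 'n::finite) \<Rightarrow> real ^ ('i \<times> 'r::finite + 'r) \<Rightarrow> real ^ ('i \<times> 'r + 'r)
    \<Rightarrow> real ^ ('i \<times> 'r + 'r) ^ ('i \<times> 'r + 'r)" where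
  "proj_jac_matrix mode w D = (\<chi> b c.
     case (b, c) of
       (Inl (i, r), Inl (i', r')) \<Rightarrow>
         if mode i = mode i' \<and> r = r' then
           (let \<nu> = block_norm mode (pos_part w) (mode i) r;
                z = (\<lambda>k. pos_part w $ Inl (k, r) / \<nu>)
            in ((if i = i' then 1 else 0) - z i * z i') / \<nu> * D $ Inl (i', r'))
         else 0
     | (Inr r, Inr r') \<Rightarrow> if r = r' then D $ Inr r' else 0
     | _ \<Rightarrow> 0)"

text \<open>The set is empty at the points \<open>w\<close> where the generalized Jacobian is not defined.\<close>

definition proj_jac :: "('i::finite \<Rightarrow> 'n::finite) \<Rightarrow> real ^ ('i \<times> 'r::finite + 'r)
    \<Rightarrow> (real ^ ('i \<times> 'r + 'r) ^ ('i \<times> 'r + 'r)) set" where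
  "proj_jac mode w = {proj_jac_matrix mode w D | D. proj_regular mode w \<and> sign_diag w D}"

definition grad_step :: "('m::finite \<Rightarrow> 'n::finite \<Rightarrow> 'i::finite) \<Rightarrow> real ^ 'm \<Rightarrow> real
    \<Rightarrow> real ^ ('i \<times> 'r::finite + 'r) \<Rightarrow> real ^ ('i \<times> 'r + 'r)" where
  "grad_step idx T \<gamma> x = x - \<gamma> *\<^sub>R (transpose (JF idx T x) *v F idx T x)"

text \<open>
  The feasible set is not convex, so \<open>closest_point\<close> makes an arbitrary choice where the
  projection is not single-valued; this does not happen where \<open>proj_regular\<close> holds.
\<close>

definition residual :: "('i::finite \<Rightarrow> 'n::finite) \<Rightarrow> ('m::finite \<Rightarrow> 'n \<Rightarrow> 'i) \<Rightarrow> real ^ 'm \<Rightarrow> real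
    \<Rightarrow> real ^ ('i \<times> 'r::finite + 'r) \<Rightarrow> real ^ ('i \<times> 'r + 'r)" where
  "residual mode idx T \<gamma> x = x - closest_point (feasible_set mode) (grad_step idx T \<gamma> x)"

definition approx_jac :: "('i::finite \<Rightarrow> 'n::finite) \<Rightarrow> ('m::finite \<Rightarrow> 'n \<Rightarrow> 'i) \<Rightarrow> real ^ 'm \<Rightarrow> real
    \<Rightarrow> real ^ ('i \<times> 'r::finite + 'r) \<Rightarrow> (real ^ ('i \<times> 'r + 'r) ^ ('i \<times> 'r + 'r)) set" where
  "approx_jac mode idx T \<gamma> x =
     {mat 1 - P ** (mat 1 - \<gamma> *\<^sub>R (transpose (JF idx T x) ** JF idx T x)) | P.
        P \<in> proj_jac mode (grad_step idx T \<gamma> x)}"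

definition newton_step :: "('i::finite \<Rightarrow> 'n::finite) \<Rightarrow> ('m::finite \<Rightarrow> 'n \<Rightarrow> 'i) \<Rightarrow> real ^ 'm \<Rightarrow> real
    \<Rightarrow> (nat \<Rightarrow> real ^ ('i \<times> 'r::finite + 'r)) \<Rightarrow> (nat \<Rightarrow> real ^ ('i \<times> 'r + 'r))
    \<Rightarrow> (nat \<Rightarrow> real ^ ('i \<times> 'r + 'r) ^ ('i \<times> 'r + 'r)) \<Rightarrow> nat \<Rightarrow> bool" where
  "newton_step mode idx T \<gamma> x d H k \<longleftrightarrow>
     H k \<in> approx_jac mode idx T \<gamma> (x k) \<and>
     H k *v d k = - residual mode idx T \<gamma> (x k) \<and>
     x (Suc k) = x k + d k"

definition q_quadratically_convergent :: "(nat \<Rightarrow> 'a::real_normed_vector) \<Rightarrow> 'a \<Rightarrow> bool" where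
  "q_quadratically_convergent x l \<longleftrightarrow>
     x \<longlonglongrightarrow> l \<and>
     (\<exists>c\<ge>0. \<forall>\<^sub>F k in sequentially. norm (x (Suc k) - l) \<le> c * (norm (x k - l))\<^sup>2)"

end

theory Submission
  imports Defs "HOL-Library.Landau_Symbols"
begin

text \<open>
  At a zero of the polynomial map \<open>F\<close> one has \<open>F x = J x (x - x\<^sup>*) + O(\<parallel>x - x\<^sup>*\<parallel>\<^sup>2)\<close>, so replacing the
  derivative of the gradient step \<open>w\<close> by \<open>I - \<gamma> J\<^sup>T J\<close> costs only a second-order error. The projection
  is normalization after the positive part. Near the feasible point \<open>x\<^sup>*\<close> the positive part is
  reproduced exactly by every admissible diagonal matrix, and normalization is smooth; hence
  \<open>\<Pi> w - x\<^sup>* - P (w - x\<^sup>*) = O(\<parallel>w - x\<^sup>*\<parallel>\<^sup>2)\<close> uniformly in \<open>P\<close>. Near \<open>x\<^sup>*\<close> the admissible diagonals are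
  among those at \<open>x\<^sup>*\<close>, which form a compact set, so nonsingularity at \<open>x\<^sup>*\<close> gives a uniform lower
  bound \<open>\<parallel>H v\<parallel> \<ge> m \<parallel>v\<parallel>\<close>. Together, \<open>H (x + d - x\<^sup>*) = O(\<parallel>x - x\<^sup>*\<parallel>\<^sup>2)\<close> for every Newton step \<open>d\<close>.
\<close>

section \<open>Second-order remainders of polynomial maps\<close>

lemma continuous_on_UNIV_tendsto_nhds:
  assumes "continuous_on UNIV f"
  shows "(f \<longlongrightarrow> f a) (nhds a)"
proof -
  have "(f \<longlongrightarrow> f a) (at a)"
    using assms unfolding continuous_on by simp
  then show ?thesis
    by (simp only: tendsto_at_iff_tendsto_nhds)
qed

text \<open>Induction over the construction of polynomials. The derivative in the remainder is taken
  at the moving point \<open>x\<close>, not at \<open>a\<close>, because the iteration evaluates map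
  and Jacobian at the current iterate. The first-order bound strengthens the induction: the product
  case multiplies two first-order differences. Working with \<open>nhds a\<close> makes the bounds
  hold at \<open>a\<close> too.\<close>

lemma real_polynomial_function_derivative_remainder:
  fixes f :: "'a::real_normed_vector \<Rightarrow> real"
  assumes "real_polynomial_function f"
  shows "\<exists>f'. (\<forall>x. (f has_derivative f' x) (at x)) \<and>
              (\<forall>h. continuous_on UNIV (\<lambda>x. f' x h)) \<and>
              (\<forall>a. (\<lambda>x. f a - f x) \<in> O[nhds a](\<lambda>x. norm (x - a))) \<and>
              (\<forall>a. (\<lambda>x. f a - f x - f' x (a - x)) \<in> O[nhds a](\<lambda>x. (norm (x - a))\<^sup>2))"
  using assms
proof (induction rule: real_polynomial_function.induct)
  case (linear f)
  obtain K where K: "\<And>x. norm (f x) \<le> norm x * K"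
    using bounded_linear.bounded[OF linear] by blast
  have "(\<lambda>x. f a - f x) \<in> O[nhds a](\<lambda>x. norm (x - a))" for a
  proof (rule bigoI[of _ K], rule always_eventually, rule allI)
    have "f a - f x = f (a - x)" for x
      by (simp add: linear linear_diff bounded_linear.linear)
    then show "norm (f a - f x) \<le> K * norm (norm (x - a))" for x
      using K[of "a - x"] by (simp add: norm_minus_commute mult.commute)
  qed
  then show ?case
    using linear by (intro exI[of _ "\<lambda>x. f"])
      (simp add: bounded_linear_imp_has_derivative linear_diff bounded_linear.linear)
next
  case (const c)
  then show ?case
    by (intro exI[of _ "\<lambda>x h. 0"]) auto
next
  case (add f g)
  then obtain f' g' where
    f: "\<And>x. (f has_derivative f' x) (at x)" "\<And>h. continuous_on UNIV (\<lambda>x. f' x h)"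
      "\<And>a. (\<lambda>x. f a - f x) \<in> O[nhds a](\<lambda>x. norm (x - a))"
      "\<And>a. (\<lambda>x. f a - f x - f' x (a - x)) \<in> O[nhds a](\<lambda>x. (norm (x - a))\<^sup>2)" and
    g: "\<And>x. (g has_derivative g' x) (at x)" "\<And>h. continuous_on UNIV (\<lambda>x. g' x h)"
      "\<And>a. (\<lambda>x. g a - g x) \<in> O[nhds a](\<lambda>x. norm (x - a))"
      "\<And>a. (\<lambda>x. g a - g x - g' x (a - x)) \<in> O[nhds a](\<lambda>x. (norm (x - a))\<^sup>2)"
    by blast
  show ?case
  proof (intro exI[of _ "\<lambda>x h. f' x h + g' x h"] conjI allI)
    show "(\<lambda>x. f a + g a - (f x + g x)) \<in> O[nhds a](\<lambda>x. norm (x - a))" for a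
      using sum_in_bigo(1)[OF f(3) g(3), of a] by (simp add: algebra_simps)
    show "(\<lambda>x. f a + g a - (f x + g x) - (f' x (a - x) + g' x (a - x)))
        \<in> O[nhds a](\<lambda>x. (norm (x - a))\<^sup>2)" for a
      using sum_in_bigo(1)[OF f(4) g(4), of a] by (simp add: algebra_simps)
    show "((\<lambda>x. f x + g x) has_derivative (\<lambda>h. f' x h + g' x h)) (at x)" for x
      by (rule has_derivative_add[OF f(1) g(1)])
    show "continuous_on UNIV (\<lambda>x. f' x h + g' x h)" for h
      by (intro continuous_on_add f g)
  qed
next
  case (mult f g)
  then obtain f' g' where
    f: "\<And>x. (f has_derivative f' x) (at x)" "\<And>h. continuous_on UNIV (\<lambda>x. f' x h)"
      "\<And>a. (\<lambda>x. f a - f x) \<in> O[nhds a](\<lambda>x. norm (x - a))"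
      "\<And>a. (\<lambda>x. f a - f x - f' x (a - x)) \<in> O[nhds a](\<lambda>x. (norm (x - a))\<^sup>2)" and
    g: "\<And>x. (g has_derivative g' x) (at x)" "\<And>h. continuous_on UNIV (\<lambda>x. g' x h)"
      "\<And>a. (\<lambda>x. g a - g x) \<in> O[nhds a](\<lambda>x. norm (x - a))"
      "\<And>a. (\<lambda>x. g a - g x - g' x (a - x)) \<in> O[nhds a](\<lambda>x. (norm (x - a))\<^sup>2)"
    by blast
  have bounded: "h \<in> O[nhds a](\<lambda>_. 1)" and cont: "continuous_on UNIV h"
    if "\<And>x. (h has_derivative h' x) (at x)" for h :: "'a \<Rightarrow> real" and h' a
  proof -
    show c: "continuous_on UNIV h"
      using that by (meson continuous_at_imp_continuous_on has_derivative_continuous)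
    have "((\<lambda>x. h x / 1) \<longlongrightarrow> h a) (nhds a)"
      using continuous_on_UNIV_tendsto_nhds[OF c] by simp
    then show "h \<in> O[nhds a](\<lambda>_. 1)"
      by (intro bigoI_tendsto[where c = "h a"]) auto
  qed
  show ?case
  proof (intro exI[of _ "\<lambda>x h. f x * g' x h + f' x h * g x"] conjI allI)
    fix a
    have sq: "(\<lambda>x. (f a - f x) * (g a - g x)) \<in> O[nhds a](\<lambda>x. (norm (x - a))\<^sup>2)"
      using landau_o.big.mult[OF f(3) g(3), of a] by (simp add: power2_eq_square)
    show "(\<lambda>x. f a * g a - f x * g x) \<in> O[nhds a](\<lambda>x. norm (x - a))"
      using sum_in_bigo(1)[OF landau_o.big_1_mult[OF f(3) bounded[OF g(1)]]
          landau_o.big_1_mult[OF g(3) bigo_const[of "f a"]], of a]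
      by (simp add: algebra_simps)
    \<comment> \<open>With \<open>Rf\<close>, \<open>Rg\<close> the remainders of the factors, the
      remainder of the product is \<open>Rf * g x + Rg * f x + (f a - f x) * (g a - g x)\<close>;
      the last term is \<open>sq\<close>.\<close>
    show "(\<lambda>x. f a * g a - f x * g x - (f x * g' x (a - x) + f' x (a - x) * g x))
        \<in> O[nhds a](\<lambda>x. (norm (x - a))\<^sup>2)"
      using sum_in_bigo(1)[OF sum_in_bigo(1)[OF landau_o.big_1_mult[OF f(4) bounded[OF g(1)]]
          landau_o.big_1_mult[OF g(4) bounded[OF f(1)]]] sq]
      by (simp add: algebra_simps)
  next
    show "((\<lambda>x. f x * g x) has_derivative (\<lambda>h. f x * g' x h + f' x h * g x)) (at x)" for x
      by (rule has_derivative_mult[OF f(1) g(1)])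
    show "continuous_on UNIV (\<lambda>x. f x * g' x h + f' x h * g x)" for h
      by (intro continuous_on_add continuous_on_mult f(2) g(2) cont[OF f(1)] cont[OF g(1)])
  qed
qed

text \<open>The scalar statements hold for each of the finitely many coordinates; the l1 norm
  assembles their remainders, and the coordinate derivatives are the rows of the Jacobian
  matrix.\<close>

lemma polynomial_jacobian:
  fixes p :: "real ^ 'k \<Rightarrow> real ^ 'm"
  assumes "\<And>m. real_polynomial_function (\<lambda>x. p x $ m)"
  shows "continuous_on UNIV (\<lambda>x. jacobian p (at x))"
    and "(\<lambda>x. norm (p a - p x - jacobian p (at x) *v (a - x))) \<in> O[nhds a](\<lambda>x. (norm (x - a))\<^sup>2)"
    and "continuous_on UNIV p"
proof -
  have "\<exists>p'. \<forall>m. (\<forall>x. ((\<lambda>x. p x $ m) has_derivative p' m x) (at x)) \<and>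
      (\<forall>h. continuous_on UNIV (\<lambda>x. p' m x h)) \<and>
      (\<forall>a. (\<lambda>x. p a $ m - p x $ m) \<in> O[nhds a](\<lambda>x. norm (x - a))) \<and>
      (\<forall>a. (\<lambda>x. p a $ m - p x $ m - p' m x (a - x)) \<in> O[nhds a](\<lambda>x. (norm (x - a))\<^sup>2))"
    by (rule choice, rule allI, rule real_polynomial_function_derivative_remainder, rule assms)
  then obtain p' where
    p': "\<And>m x. ((\<lambda>x. p x $ m) has_derivative p' m x) (at x)"
      "\<And>m h. continuous_on UNIV (\<lambda>x. p' m x h)"
      "\<And>m a. (\<lambda>x. p a $ m - p x $ m - p' m x (a - x)) \<in> O[nhds a](\<lambda>x. (norm (x - a))\<^sup>2)"
    by (elim exE) (rule that, blast+)
  have deriv: "(p has_derivative (\<lambda>h. \<chi> m. p' m x h)) (at x)" for x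
    unfolding has_derivative_componentwise_within[of p]
  proof
    fix b :: "real ^ 'm"
    assume "b \<in> Basis"
    then obtain m where "b = axis m 1"
      by (auto simp: Basis_vec_def)
    then show "((\<lambda>x. p x \<bullet> b) has_derivative (\<lambda>h. (\<chi> m. p' m x h) \<bullet> b)) (at x)"
      using p'(1)[of m x] by (simp add: inner_axis)
  qed
  then show "continuous_on UNIV p"
    by (meson continuous_at_imp_continuous_on has_derivative_continuous)
  have frechet: "frechet_derivative p (at x) = (\<lambda>h. \<chi> m. p' m x h)" for x
    using frechet_derivative_at[OF deriv] by simp
  have "linear (\<lambda>h. \<chi> m. p' m x h)" for x
    using deriv has_derivative_linear by blast
  then have jac: "jacobian p (at x) *v h = (\<chi> m. p' m x h)" for x h
    unfolding jacobian_def frechet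
    by (intro matrix_works) (simp add: linear_matrix_vector_mul_eq)
  show "continuous_on UNIV (\<lambda>x. jacobian p (at x))"
    unfolding jacobian_def frechet matrix_def
    by (auto intro!: continuous_intros p')
  have "(\<lambda>x. norm (p a - p x - jacobian p (at x) *v (a - x)))
      \<in> O[nhds a](\<lambda>x. \<Sum>m\<in>UNIV. \<bar>p a $ m - p x $ m - p' m x (a - x)\<bar>)"
  proof (rule bigoI[of _ 1], rule always_eventually, rule allI)
    show "norm (norm (p a - p x - jacobian p (at x) *v (a - x)))
        \<le> 1 * norm (\<Sum>m\<in>UNIV. \<bar>p a $ m - p x $ m - p' m x (a - x)\<bar>)" for x
      using norm_le_l1_cart[of "p a - p x - jacobian p (at x) *v (a - x)"] by (simp add: jac)
  qed
  also have "(\<lambda>x. \<Sum>m\<in>UNIV. \<bar>p a $ m - p x $ m - p' m x (a - x)\<bar>)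
      \<in> O[nhds a](\<lambda>x. (norm (x - a))\<^sup>2)"
    by (intro big_sum_in_bigo) (simp add: p'(3))
  finally show "(\<lambda>x. norm (p a - p x - jacobian p (at x) *v (a - x)))
      \<in> O[nhds a](\<lambda>x. (norm (x - a))\<^sup>2)" .
qed

lemma real_polynomial_function_F: "real_polynomial_function (\<lambda>x. F idx T x $ m)"
proof -
  have coord: "real_polynomial_function (\<lambda>x. x $ c)" for c
    by (simp add: bounded_linear_vec_nth real_polynomial_function.intros(1))
  have "real_polynomial_function
      (\<lambda>x. (\<Sum>r\<in>UNIV. x $ Inr r * (\<Prod>n\<in>UNIV. x $ Inl (idx m n, r))) - T $ m)"
    by (intro real_polynomial_function_diff real_polynomial_function_sum finite
        real_polynomial_function.intros(4) real_polynomial_function_prod coord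
        real_polynomial_function.intros(2))
  then show ?thesis
    by (simp add: F_def)
qed

section \<open>Uniform nonsingularity of a compact family of matrices\<close>

text \<open>On the compact set of pairs of some \<open>D\<close> in \<open>S\<close> and a unit
  vector, \<open>norm (H (a, D) *v v)\<close> attains a positive minimum. Uniform continuity keeps
  at least half of it when \<open>a\<close> is replaced by a nearby \<open>x\<close>, with one
  radius for all \<open>D\<close>; homogeneity extends the bound to all \<open>v\<close>.\<close>

lemma uniformly_nonsingular_near:
  fixes H :: "'a::{metric_space, heine_borel} \<times> 'b::metric_space \<Rightarrow> real ^ 'k ^ 'k"
  assumes \<rho>: "\<rho> > 0" and S: "compact S"
    and cont: "continuous_on (cball a \<rho> \<times> S) H"
    and inv: "\<And>D. D \<in> S \<Longrightarrow> invertible (H (a, D))"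
  obtains m \<delta> where "m > 0" "\<delta> > 0" "\<delta> \<le> \<rho>"
    "\<And>x D v. x \<in> cball a \<delta> \<Longrightarrow> D \<in> S \<Longrightarrow> m * norm v \<le> norm (H (x, D) *v v)"
proof (cases "S = {}")
  case True
  then show ?thesis using that[of 1 \<rho>] \<rho> by auto
next
  case False
  define K where "K = (cball a \<rho> \<times> S) \<times> sphere (0::real ^ 'k) 1"
  define \<phi> where "\<phi> = (\<lambda>(q, v). norm (H q *v v))"
  have "compact K"
    unfolding K_def by (intro compact_Times S compact_cball compact_sphere)
  have cont\<phi>: "continuous_on K \<phi>"
  proof -
    have "continuous_on K (\<lambda>p. H (fst p))"
      by (rule continuous_on_compose2[OF cont]) (auto simp: K_def intro!: continuous_intros)
    then show ?thesis
      unfolding \<phi>_def case_prod_unfold matrix_vector_mult_def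
      by (intro continuous_intros)
  qed
  define K0 where "K0 = ({a} \<times> S) \<times> sphere (0::real ^ 'k) 1"
  have "K0 \<noteq> {}" "compact K0" "K0 \<subseteq> K"
    using False \<rho> by (auto simp: K0_def K_def intro!: compact_Times S)
  then obtain p0 where p0: "p0 \<in> K0" "\<And>p. p \<in> K0 \<Longrightarrow> \<phi> p0 \<le> \<phi> p"
    using continuous_attains_inf[of K0 \<phi>] cont\<phi> continuous_on_subset by metis
  have pos: "\<phi> p0 > 0"
  proof -
    obtain D v where p0_eq: "p0 = ((a, D), v)" "D \<in> S" "norm v = 1"
      using p0(1) by (auto simp: K0_def)
    have "H (a, D) *v v \<noteq> 0"
    proof
      assume "H (a, D) *v v = 0"
      then have "v = 0"
        using inv[OF p0_eq(2)] by (metis invertible_left_inverse matrix_left_invertible_ker)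
      then show False using p0_eq by simp
    qed
    then show ?thesis by (simp add: p0_eq \<phi>_def)
  qed
  obtain \<eta> where \<eta>: "\<eta> > 0" "\<And>p q. p \<in> K \<Longrightarrow> q \<in> K \<Longrightarrow> dist p q < \<eta> \<Longrightarrow> dist (\<phi> p) (\<phi> q) < \<phi> p0 / 2"
    using compact_uniformly_continuous[OF cont\<phi> \<open>compact K\<close>] pos
    unfolding uniformly_continuous_on_def by (metis half_gt_zero)
  \<comment> \<open>Halving turns the non-strict bound of the closed ball into the strict
    \<open>< \<eta>\<close> of uniform continuity.\<close>
  define \<delta> where "\<delta> = min \<rho> (\<eta> / 2)"
  have bound: "\<phi> p0 / 2 \<le> norm (H (x, D) *v v)"
    if "x \<in> cball a \<delta>" "D \<in> S" "norm v = 1" for x D v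
  proof -
    have "dist ((x, D), v) ((a, D), v) < \<eta>"
      using that \<eta>(1) by (simp add: dist_Pair_Pair \<delta>_def dist_commute)
    then have "dist (\<phi> ((x, D), v)) (\<phi> ((a, D), v)) < \<phi> p0 / 2"
      using that \<rho> by (intro \<eta>(2)) (auto simp: K_def \<delta>_def)
    moreover have "\<phi> p0 \<le> \<phi> ((a, D), v)"
      using that by (intro p0(2)) (auto simp: K0_def)
    ultimately show ?thesis
      by (simp add: \<phi>_def dist_real_def abs_if split: if_splits)
  qed
  show ?thesis
  proof (rule that[of "\<phi> p0 / 2" \<delta>])
    fix x D v
    assume *: "x \<in> cball a \<delta>" "D \<in> S"
    show "\<phi> p0 / 2 * norm v \<le> norm (H (x, D) *v v)"
    proof (cases "v = 0")
      case False
      then have "\<phi> p0 / 2 \<le> norm (H (x, D) *v ((1 / norm v) *\<^sub>R v))"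
        by (intro bound *) auto
      also have "\<dots> = norm (H (x, D) *v v) / norm v"
        by (simp add: matrix_vector_mult_scaleR)
      finally show ?thesis
        using False by (simp add: field_simps)
    qed simp
  qed (use pos \<rho> \<eta> in \<open>auto simp: \<delta>_def\<close>)
qed

text \<open>A continuous image of a compact set is bounded, and Cauchy-Schwarz on each row bounds
  the action of a matrix by its norm. The dimension factor is crude, but only uniformity
  matters.\<close>

lemma matrix_vector_mult_uniformly_bounded:
  fixes H :: "'a::topological_space \<Rightarrow> real ^ 'k ^ 'l"
  assumes "compact S" "continuous_on S H"
  obtains B where "B > 0" "\<And>x v. x \<in> S \<Longrightarrow> norm (H x *v v) \<le> B * norm v"
proof -
  have "bounded (H ` S)"
    using assms compact_continuous_image compact_imp_bounded by blast
  then obtain B where B: "B > 0" "\<And>x. x \<in> S \<Longrightarrow> norm (H x) \<le> B"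
    by (auto simp: bounded_pos)
  have "norm (A *v v) \<le> real CARD('l) * norm A * norm v" for A :: "real ^ 'k ^ 'l" and v
  proof -
    have "norm (A *v v) \<le> (\<Sum>i\<in>UNIV. \<bar>(A *v v) $ i\<bar>)"
      by (rule norm_le_l1_cart)
    also have "\<dots> \<le> (\<Sum>i\<in>(UNIV::'l set). norm A * norm v)"
    proof (rule sum_mono)
      fix i
      have "\<bar>(A *v v) $ i\<bar> \<le> norm (A $ i) * norm v"
        unfolding matrix_vector_mul_component by (rule Cauchy_Schwarz_ineq2)
      also have "\<dots> \<le> norm A * norm v"
        by (intro mult_right_mono Finite_Cartesian_Product.norm_nth_le) auto
      finally show "\<bar>(A *v v) $ i\<bar> \<le> norm A * norm v" .
    qed
    finally show ?thesis by (simp add: mult_ac)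
  qed
  then have "norm (H x *v v) \<le> real CARD('l) * B * norm v" if "x \<in> S" for x v
    using B that by (meson mult_left_mono mult_right_mono norm_ge_zero of_nat_0_le_iff order_trans)
  then show ?thesis
    using B by (intro that[of "real CARD('l) * B"]) auto
qed

section \<open>The projection onto the feasible set\<close>

text \<open>Applied to \<open>pos_part w\<close>, this is the closed form of the projection at
  regular \<open>w\<close>.\<close>

definition block_normalize :: "('i::finite \<Rightarrow> 'n::finite) \<Rightarrow> real ^ ('i \<times> 'r::finite + 'r) \<Rightarrow> real ^ ('i \<times> 'r + 'r)" where
  "block_normalize mode u = (\<chi> c. case c of
     Inl (i, r) \<Rightarrow> u $ Inl (i, r) / block_norm mode u (mode i) r
   | Inr r \<Rightarrow> u $ Inr r)"

lemma block_normalize_nth [simp]: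
  "block_normalize mode u $ Inl (i, r) = u $ Inl (i, r) / block_norm mode u (mode i) r"
  "block_normalize mode u $ Inr r = u $ Inr r"
  by (simp_all add: block_normalize_def)

lemma block_norm_nonneg: "0 \<le> block_norm mode u n r"
  by (simp add: block_norm_def)

lemma block_norm_power2: "(block_norm mode u n r)\<^sup>2 = (\<Sum>i | mode i = n. (u $ Inl (i, r))\<^sup>2)"
  by (simp add: block_norm_def L2_set_def sum_nonneg)

lemma proj_regular_iff: "proj_regular mode w \<longleftrightarrow> (\<forall>n r. 0 < block_norm mode (pos_part w) n r)"
proof -
  have "block_norm mode (pos_part w) n r = 0 \<longleftrightarrow> (\<forall>i. mode i = n \<longrightarrow> pos_part w $ Inl (i, r) = 0)" for n r
    by (auto simp: block_norm_def L2_set_eq_0_iff)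
  then show ?thesis
    unfolding proj_regular_def using block_norm_nonneg[of mode "pos_part w"]
    by (metis less_le order_less_irrefl)
qed

lemma sum_blocks:
  fixes mode :: "'i::finite \<Rightarrow> 'n::finite" and g :: "'i \<times> 'r::finite + 'r \<Rightarrow> real"
  shows "sum g UNIV = (\<Sum>r\<in>UNIV. \<Sum>n\<in>UNIV. \<Sum>i | mode i = n. g (Inl (i, r))) + (\<Sum>r\<in>UNIV. g (Inr r))"
proof -
  have "sum g UNIV = (\<Sum>p\<in>UNIV. g (Inl p)) + (\<Sum>r\<in>UNIV. g (Inr r))"
    by (simp add: sum.Plus flip: UNIV_Plus_UNIV)
  also have "(\<Sum>p\<in>UNIV. g (Inl p)) = (\<Sum>i\<in>UNIV. \<Sum>r\<in>UNIV. g (Inl (i, r)))"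
    by (simp add: sum.cartesian_product)
  also have "\<dots> = (\<Sum>r\<in>UNIV. \<Sum>i\<in>UNIV. g (Inl (i, r)))"
    by (rule sum.swap)
  also have "\<dots> = (\<Sum>r\<in>UNIV. \<Sum>n\<in>UNIV. \<Sum>i | mode i = n. g (Inl (i, r)))"
    using sum.group[of UNIV UNIV mode "\<lambda>i. g (Inl (i, _))"] by simp
  finally show ?thesis .
qed

lemma block_normalize_feasible:
  assumes "\<And>c. 0 \<le> u $ c" "\<And>n r. 0 < block_norm mode u n r"
  shows "block_normalize mode u \<in> feasible_set mode"
proof -
  have "(block_norm mode (block_normalize mode u) n r)\<^sup>2 = 1" for n r
  proof -
    have "(block_norm mode (block_normalize mode u) n r)\<^sup>2
        = (\<Sum>i | mode i = n. (u $ Inl (i, r))\<^sup>2 / (block_norm mode u n r)\<^sup>2)"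
      by (simp add: block_norm_power2 [of mode "block_normalize mode u"] power_divide)
    also have "\<dots> = 1"
      using assms(2)[of n r] by (simp add: sum_divide_distrib[symmetric] block_norm_power2[symmetric])
    finally show ?thesis .
  qed
  then have "block_norm mode (block_normalize mode u) n r = 1" for n r
    using block_norm_nonneg[of mode "block_normalize mode u" n r] by (metis power2_eq_1_iff zero_le_one
      neg_0_le_iff_le not_one_le_zero)
  moreover have "0 \<le> block_normalize mode u $ c" for c
    using assms(1) by (cases c) (auto intro!: divide_nonneg_nonneg block_norm_nonneg)
  ultimately show ?thesis
    by (simp add: feasible_set_def)
qed

text \<open>The feasible set is not convex, so minimality is shown directly: for feasible
  \<open>z\<close>, \<open>(dist w z)\<^sup>2 - (dist w p)\<^sup>2\<close> is at least a positively
  weighted sum of the squares \<open>(z $ c - p $ c)\<^sup>2\<close>. This growth also gives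
  uniqueness, which determines the choice made by \<open>closest_point\<close>.\<close>

lemma closest_point_feasible_set:
  fixes w :: "real ^ ('i::finite \<times> 'r::finite + 'r)"
  assumes "proj_regular mode w"
  shows "closest_point (feasible_set mode) w = block_normalize mode (pos_part w)"
proof -
  define p where "p = block_normalize mode (pos_part w)"
  let ?t = "block_norm mode (pos_part w)"
  have t: "0 < ?t n r" for n r
    using assms by (simp add: proj_regular_iff)
  have p: "p \<in> feasible_set mode"
    unfolding p_def by (rule block_normalize_feasible) (rule t | simp add: pos_part_def)+
  have closer: "dist w p < dist w z" if z: "z \<in> feasible_set mode" "z \<noteq> p" for z
  proof -
    \<comment> \<open>The weight of a vector block is the norm of its positive part, for which the
      terms quadratic in \<open>z\<close> and \<open>p\<close> cancel after summation;
      \<open>g\<close> is the slack of the growth inequality at one coordinate.\<close>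
    define \<kappa> where "\<kappa> c = (case c of Inl (i, r) \<Rightarrow> ?t (mode i) r | Inr r \<Rightarrow> 1)" for c :: "'i \<times> 'r + 'r"
    define g where "g c = (w $ c - z $ c)\<^sup>2 - (w $ c - p $ c)\<^sup>2 - \<kappa> c * (z $ c - p $ c)\<^sup>2" for c
    have nonneg: "0 \<le> z $ c" for c
      using z by (simp add: feasible_set_def)
    have "0 \<le> (\<Sum>i | mode i = n. g (Inl (i, r)))" for n r
    proof -
      let ?A = "{i. mode i = n}"
      have sq: "(\<Sum>i\<in>?A. (z $ Inl (i, r))\<^sup>2) = 1" "(\<Sum>i\<in>?A. (p $ Inl (i, r))\<^sup>2) = 1"
        using z p by (simp_all add: block_norm_power2[symmetric] feasible_set_def)
      \<comment> \<open>Summed over the block, the first three terms give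
        \<open>(1 - t) - (1 + t) + 2 * t = 0\<close>, where \<open>t\<close> is the norm of the
        positive part. What remains is nonnegative, as \<open>z\<close> and
        \<open>pos_part w - w\<close> are.\<close>
      have eq: "g (Inl (i, r)) = (1 - ?t n r) * (z $ Inl (i, r))\<^sup>2 - (1 + ?t n r) * (p $ Inl (i, r))\<^sup>2
          + 2 * (pos_part w $ Inl (i, r))\<^sup>2 / ?t n r
          + 2 * z $ Inl (i, r) * (pos_part w $ Inl (i, r) - w $ Inl (i, r))" if "i \<in> ?A" for i
      proof -
        have 1: "?t n r * p $ Inl (i, r) = pos_part w $ Inl (i, r)"
          using that t[of n r] by (simp add: p_def)
        have 2: "w $ Inl (i, r) * p $ Inl (i, r) = (pos_part w $ Inl (i, r))\<^sup>2 / ?t n r"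
          using that t[of n r] by (simp add: p_def pos_part_def power2_eq_square max_def)
        have "g (Inl (i, r)) = (1 - ?t n r) * (z $ Inl (i, r))\<^sup>2 - (1 + ?t n r) * (p $ Inl (i, r))\<^sup>2
          + 2 * (w $ Inl (i, r) * p $ Inl (i, r))
          + 2 * z $ Inl (i, r) * (?t n r * p $ Inl (i, r) - w $ Inl (i, r))"
          using that by (simp add: g_def \<kappa>_def power2_eq_square algebra_simps)
        then show ?thesis
          unfolding 1 2 by simp
      qed
      have "(\<Sum>i\<in>?A. g (Inl (i, r))) = (1 - ?t n r) * (\<Sum>i\<in>?A. (z $ Inl (i, r))\<^sup>2)
          - (1 + ?t n r) * (\<Sum>i\<in>?A. (p $ Inl (i, r))\<^sup>2) + 2 * (?t n r)\<^sup>2 / ?t n r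
          + (\<Sum>i\<in>?A. 2 * z $ Inl (i, r) * (pos_part w $ Inl (i, r) - w $ Inl (i, r)))"
        unfolding block_norm_power2
        by (simp only: eq sum.distrib sum_subtractf sum_distrib_left sum_divide_distrib cong: sum.cong)
      also have "\<dots> = (\<Sum>i\<in>?A. 2 * z $ Inl (i, r) * (pos_part w $ Inl (i, r) - w $ Inl (i, r)))"
        unfolding sq using t[of n r] by (simp add: power2_eq_square)
      also have "\<dots> \<ge> 0"
        by (intro sum_nonneg mult_nonneg_nonneg) (simp_all add: nonneg pos_part_def)
      finally show ?thesis .
    qed
    moreover have "0 \<le> g (Inr r)" for r
    proof -
      have "g (Inr r) = 2 * (pos_part w $ Inr r - w $ Inr r) * z $ Inr r"
        by (simp add: g_def \<kappa>_def p_def pos_part_def max_def power2_eq_square algebra_simps)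
      then show ?thesis
        by (simp add: nonneg pos_part_def)
    qed
    ultimately have "0 \<le> sum g UNIV"
      unfolding sum_blocks[of g mode]
      by (intro add_nonneg_nonneg sum_nonneg[where A = UNIV]) simp_all
    moreover have "sum g UNIV = (dist w z)\<^sup>2 - (dist w p)\<^sup>2 - (\<Sum>c\<in>UNIV. \<kappa> c * (z $ c - p $ c)\<^sup>2)"
      by (simp add: g_def sum_subtractf dist_norm norm_vec_def L2_set_def sum_nonneg)
    moreover have "0 < (\<Sum>c\<in>UNIV. \<kappa> c * (z $ c - p $ c)\<^sup>2)"
    proof -
      have \<kappa>: "0 < \<kappa> c" for c
        using t by (simp add: \<kappa>_def split: sum.split)
      obtain c where "z $ c \<noteq> p $ c"
        using z(2) by (auto simp: vec_eq_iff)
      then show ?thesis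
        using \<kappa> by (intro sum_pos2[of _ c]) (auto simp: less_imp_le)
    qed
    ultimately have "(dist w p)\<^sup>2 < (dist w z)\<^sup>2"
      by linarith
    then show ?thesis
      by (rule power2_less_imp_less) simp
  qed
  show ?thesis
    unfolding closest_point_def p_def[symmetric]
  proof (rule some_equality)
    show "p \<in> feasible_set mode \<and> (\<forall>y\<in>feasible_set mode. dist w p \<le> dist w y)"
      using p closer by (metis less_imp_le order_refl)
    show "z = p" if "z \<in> feasible_set mode \<and> (\<forall>y\<in>feasible_set mode. dist w z \<le> dist w y)" for z
      using that p closer by (meson not_le)
  qed
qed

section \<open>The generalized Jacobian of the projection\<close>

text \<open>The products \<open>D * h\<close> are kept together because, for
  \<open>h = w - x\<close>, each of them becomes a coordinate of \<open>pos_part w - x\<close>; the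
  result then has the shape treated in \<open>normalization_remainder\<close>.\<close>

lemma proj_jac_matrix_mult_nth:
  fixes w :: "real ^ ('i::finite \<times> 'r::finite + 'r)" and mode :: "'i \<Rightarrow> 'n::finite"
  defines "\<nu> \<equiv> block_norm mode (pos_part w)"
  shows "(proj_jac_matrix mode w D *v h) $ Inl (i, r) =
      (D $ Inl (i, r) * h $ Inl (i, r)
        - pos_part w $ Inl (i, r) / \<nu> (mode i) r *
          (\<Sum>k | mode k = mode i. pos_part w $ Inl (k, r) / \<nu> (mode i) r * (D $ Inl (k, r) * h $ Inl (k, r))))
      / \<nu> (mode i) r"
    and "(proj_jac_matrix mode w D *v h) $ Inr r = D $ Inr r * h $ Inr r"
proof -
  let ?P = "proj_jac_matrix mode w D" and ?A = "{k. mode k = mode i}" and ?t = "\<nu> (mode i) r"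
  let ?z = "\<lambda>k. pos_part w $ Inl (k, r) / ?t"
  have "(?P *v h) $ Inl (i, r) = (\<Sum>c\<in>UNIV. ?P $ Inl (i, r) $ c * h $ c)"
    by (simp add: matrix_vector_mult_def)
  also have "\<dots> = (\<Sum>c\<in>(\<lambda>k. Inl (k, r)) ` ?A. ?P $ Inl (i, r) $ c * h $ c)"
    by (rule sum.mono_neutral_right) (auto simp: proj_jac_matrix_def split: sum.splits)
  also have "\<dots> = (\<Sum>k\<in>?A. ?P $ Inl (i, r) $ Inl (k, r) * h $ Inl (k, r))"
    by (subst sum.reindex) (auto simp: inj_on_def)
  also have "\<dots> = (\<Sum>k\<in>?A. ((if k = i then D $ Inl (k, r) * h $ Inl (k, r) else 0)
      - ?z i * (?z k * (D $ Inl (k, r) * h $ Inl (k, r)))) / ?t)"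
    by (rule sum.cong) (auto simp: proj_jac_matrix_def Let_def \<nu>_def algebra_simps)
  also have "\<dots> = (D $ Inl (i, r) * h $ Inl (i, r)
      - ?z i * (\<Sum>k\<in>?A. ?z k * (D $ Inl (k, r) * h $ Inl (k, r)))) / ?t"
    by (simp add: sum_divide_distrib[symmetric] sum_subtractf sum_distrib_left)
  finally show "(?P *v h) $ Inl (i, r) = \<dots>" .
  have "(?P *v h) $ Inr r = (\<Sum>c\<in>UNIV. ?P $ Inr r $ c * h $ c)"
    by (simp add: matrix_vector_mult_def)
  also have "\<dots> = (\<Sum>c\<in>{Inr r}. ?P $ Inr r $ c * h $ c)"
    by (rule sum.mono_neutral_right) (auto simp: proj_jac_matrix_def split: sum.splits)
  finally show "(?P *v h) $ Inr r = D $ Inr r * h $ Inr r"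
    by (simp add: proj_jac_matrix_def)
qed

text \<open>With \<open>z = u / \<parallel>u\<parallel>\<close> and \<open>t = \<parallel>u\<parallel>\<close>, the remainder equals
  \<open>((t - 1) (z - s) + (1 - \<langle>z, s\<rangle>) z) / t\<close>, where \<open>1 - \<langle>z, s\<rangle> = \<parallel>z - s\<parallel>\<^sup>2 / 2\<close>.\<close>

lemma normalization_remainder:
  fixes u s :: "'a \<Rightarrow> real" and A :: "'a set"
  defines "t \<equiv> L2_set u A"
  assumes "finite A" "i \<in> A" and s: "L2_set s A = 1" and t: "1 / 2 \<le> t"
    and e: "L2_set (\<lambda>k. u k - s k) A \<le> e"
  shows "\<bar>u i / t - s i - (u i - s i - u i / t * (\<Sum>k\<in>A. u k / t * (u k - s k))) / t\<bar>
    \<le> (8 + 16 * real (card A)) * e\<^sup>2"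
proof -
  have abs_le: "\<bar>f k\<bar> \<le> L2_set f A" if "k \<in> A" for f :: "'a \<Rightarrow> real" and k
    using member_le_L2_set[OF \<open>finite A\<close> that, of "\<lambda>k. \<bar>f k\<bar>"] by (simp add: L2_set_def)
  have e0: "0 \<le> e"
    using e L2_set_nonneg order_trans by blast
  have t0: "0 < t" using t by simp
  define z where "z k = u k / t" for k
  define c where "c = (\<Sum>k\<in>A. z k * s k)"
  have u: "u k = t * z k" for k
    using t0 by (simp add: z_def)
  have sum_u: "(\<Sum>k\<in>A. (u k)\<^sup>2) = t\<^sup>2"
    by (simp add: t_def L2_set_def sum_nonneg)
  have sum_z: "(\<Sum>k\<in>A. (z k)\<^sup>2) = 1"
    using sum_u t0 by (simp add: z_def power_divide sum_divide_distrib[symmetric])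
  have sum_s: "(\<Sum>k\<in>A. (s k)\<^sup>2) = 1"
    using s by (simp add: L2_set_def)
  have t1: "\<bar>t - 1\<bar> \<le> e"
  proof -
    have "t \<le> 1 + e"
      using L2_set_triangle_ineq[of s "\<lambda>k. u k - s k" A] s e by (simp add: t_def)
    moreover have "1 \<le> t + e"
      using L2_set_triangle_ineq[of u "\<lambda>k. s k - u k" A] s e
      by (simp add: t_def L2_set_def power2_commute)
    ultimately show ?thesis by linarith
  qed
  \<comment> \<open>The identity \<open>t * (z k - s k) = (u k - s k) - (t - 1) * s k\<close> bounds
    the left side by \<open>2 * e\<close>; dividing by \<open>t \<ge> 1 / 2\<close> doubles
    this.\<close>
  have zs: "\<bar>z k - s k\<bar> \<le> 4 * e" if "k \<in> A" for k
  proof -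
    have "t * (z k - s k) = (u k - s k) - (t - 1) * s k"
      by (simp add: u algebra_simps)
    then have "t * \<bar>z k - s k\<bar> = \<bar>(u k - s k) - (t - 1) * s k\<bar>"
      using t0 by (metis abs_mult abs_of_pos)
    also have "\<dots> \<le> \<bar>u k - s k\<bar> + \<bar>t - 1\<bar> * \<bar>s k\<bar>"
      by (metis abs_mult abs_triangle_ineq4)
    also have "\<dots> \<le> e + e * 1"
      using abs_le[OF that, of "\<lambda>k. u k - s k"] abs_le[OF that, of s] e s t1 e0
      by (intro add_mono mult_mono) auto
    finally have "t * \<bar>z k - s k\<bar> \<le> 2 * e" by simp
    moreover have "1 / 2 * \<bar>z k - s k\<bar> \<le> t * \<bar>z k - s k\<bar>"
      by (rule mult_right_mono[OF t]) simp
    ultimately show ?thesis by simp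
  qed
  have "2 * (1 - c) = (\<Sum>k\<in>A. (z k - s k)\<^sup>2)"
    by (simp add: power2_diff sum.distrib sum_subtractf sum_z sum_s c_def sum_distrib_left mult.assoc)
  also have "\<dots> \<le> (\<Sum>k\<in>A. 16 * e\<^sup>2)"
  proof (rule sum_mono)
    fix k assume "k \<in> A"
    then have "\<bar>z k - s k\<bar>\<^sup>2 \<le> (4 * e)\<^sup>2"
      using zs by (intro power_mono) auto
    then show "(z k - s k)\<^sup>2 \<le> 16 * e\<^sup>2" by (simp add: power_mult_distrib)
  qed
  finally have c1: "1 - c \<le> 8 * real (card A) * e\<^sup>2" by simp
  have c0: "0 \<le> 1 - c"
    using \<open>2 * (1 - c) = _\<close> sum_nonneg[of A "\<lambda>k. (z k - s k)\<^sup>2"] by simp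
  have zi: "\<bar>z i\<bar> \<le> 1"
    using abs_le[OF \<open>i \<in> A\<close>, of z] sum_z by (simp add: L2_set_def)
  have "(\<Sum>k\<in>A. z k * (u k - s k)) = t * (\<Sum>k\<in>A. (z k)\<^sup>2) - c"
    by (simp add: u c_def sum_subtractf right_diff_distrib sum_distrib_left power2_eq_square mult_ac)
  then have inner: "(\<Sum>k\<in>A. z k * (u k - s k)) = t - c"
    by (simp add: sum_z)
  have "u i / t - s i - (u i - s i - u i / t * (\<Sum>k\<in>A. u k / t * (u k - s k))) / t
      = z i - s i - (u i - s i - z i * (t - c)) / t"
    by (simp add: inner flip: z_def)
  also have "\<dots> = ((t - 1) * (z i - s i) + (1 - c) * z i) / t"
    using t0 by (simp add: u field_simps)
  finally have "\<bar>u i / t - s i - (u i - s i - u i / t * (\<Sum>k\<in>A. u k / t * (u k - s k))) / t\<bar>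
      = \<bar>(t - 1) * (z i - s i) + (1 - c) * z i\<bar> / t"
    using t0 by simp
  \<comment> \<open>The term \<open>4 * e\<^sup>2\<close> comes from
    \<open>\<bar>t - 1\<bar> \<le> e\<close> and \<open>zs\<close>, the other from
    \<open>c1\<close>.\<close>
  also have "\<dots> \<le> (4 * e\<^sup>2 + 8 * real (card A) * e\<^sup>2) / (1 / 2)"
  proof (rule frac_le)
    have "\<bar>(t - 1) * (z i - s i) + (1 - c) * z i\<bar> \<le> \<bar>t - 1\<bar> * \<bar>z i - s i\<bar> + \<bar>1 - c\<bar> * \<bar>z i\<bar>"
      by (metis abs_mult abs_triangle_ineq)
    also have "\<dots> \<le> e * (4 * e) + 8 * real (card A) * e\<^sup>2 * 1"
      using t1 zs[OF \<open>i \<in> A\<close>] c0 c1 zi e0 by (intro add_mono mult_mono) auto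
    finally show "\<bar>(t - 1) * (z i - s i) + (1 - c) * z i\<bar> \<le> 4 * e\<^sup>2 + 8 * real (card A) * e\<^sup>2"
      by (simp add: power2_eq_square)
  qed (use t in auto)
  finally show ?thesis by (simp add: algebra_simps)
qed

text \<open>If \<open>w\<close> is close to a nonnegative point \<open>x\<close>, then \<open>[w]\<^sub>+ = D w\<close> and \<open>x = D x\<close> hold exactly for
  every admissible \<open>D\<close>, so that only the normalization contributes to the remainder.\<close>

lemma projection_remainder:
  fixes w x :: "real ^ ('i::finite \<times> 'r::finite + 'r)"
  assumes x: "x \<in> feasible_set mode" and D: "sign_diag w D"
    and w: "\<And>c. 0 < x $ c \<Longrightarrow> 0 < w $ c" "\<And>n r. 1 / 2 \<le> block_norm mode (pos_part w) n r"
  shows "norm (block_normalize mode (pos_part w) - x - proj_jac_matrix mode w D *v (w - x))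
    \<le> real CARD('i \<times> 'r + 'r) * (8 + 16 * real CARD('i)) * (norm (w - x))\<^sup>2"
proof -
  let ?u = "pos_part w"
  let ?E = "block_normalize mode ?u - x - proj_jac_matrix mode w D *v (w - x)"
  have Dw: "D $ c * (w - x) $ c = ?u $ c - x $ c" for c
  proof -
    have "0 \<le> x $ c" using x by (simp add: feasible_set_def)
    \<comment> \<open>A positive coordinate of \<open>x\<close> forces a positive one of
      \<open>w\<close>, so \<open>x $ c\<close> vanishes in the last two cases and the value of
      \<open>D $ c\<close> at a zero of \<open>w\<close> has no influence.\<close>
    then consider "0 < w $ c" | "w $ c = 0" "x $ c = 0" | "w $ c < 0" "x $ c = 0"
      using w(1)[of c] by force
    then show ?thesis
      using D by cases (auto simp: sign_diag_def pos_part_def)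
  qed
  have u_x: "\<bar>?u $ c - x $ c\<bar> \<le> \<bar>w $ c - x $ c\<bar>" for c
  proof -
    have "0 \<le> x $ c" using x by (simp add: feasible_set_def)
    then show ?thesis by (simp add: pos_part_def max_def)
  qed
  have comp: "\<bar>?E $ c\<bar> \<le> (8 + 16 * real CARD('i)) * (norm (w - x))\<^sup>2" for c
  proof (cases c)
    case (Inl p)
    obtain i r where p: "p = (i, r)" by fastforce
    let ?A = "{k. mode k = mode i}" and ?t = "block_norm mode ?u (mode i) r"
    have "L2_set (\<lambda>k. ?u $ Inl (k, r) - x $ Inl (k, r)) ?A \<le> L2_set (\<lambda>c. (w - x) $ c) (range Inl)"
    proof -
      have "(\<Sum>k\<in>?A. (?u $ Inl (k, r) - x $ Inl (k, r))\<^sup>2) \<le> (\<Sum>k\<in>?A. ((w - x) $ Inl (k, r))\<^sup>2)"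
        using u_x by (intro sum_mono) (simp add: abs_le_square_iff)
      also have "\<dots> = (\<Sum>c\<in>(\<lambda>k. Inl (k, r)) ` ?A. ((w - x) $ c)\<^sup>2)"
        by (subst sum.reindex) (auto simp: inj_on_def)
      also have "\<dots> \<le> (\<Sum>c\<in>range Inl. ((w - x) $ c)\<^sup>2)"
        by (rule sum_mono2) auto
      finally show ?thesis
        by (simp add: L2_set_def)
    qed
    also have "\<dots> \<le> norm (w - x)"
      unfolding norm_vec_def L2_set_def by (auto intro!: sum_mono2)
    finally have dist: "L2_set (\<lambda>k. ?u $ Inl (k, r) - x $ Inl (k, r)) ?A \<le> norm (w - x)" .
    have "?E $ c = ?u $ Inl (i, r) / ?t - x $ Inl (i, r)
      - (?u $ Inl (i, r) - x $ Inl (i, r) - ?u $ Inl (i, r) / ?t *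
          (\<Sum>k\<in>?A. ?u $ Inl (k, r) / ?t * (?u $ Inl (k, r) - x $ Inl (k, r)))) / ?t"
      by (simp only: Inl p vector_minus_component proj_jac_matrix_mult_nth Dw[unfolded vector_minus_component]
          block_normalize_nth)
    also have "\<bar>\<dots>\<bar> \<le> (8 + 16 * real (card ?A)) * (norm (w - x))\<^sup>2"
      using normalization_remainder[of ?A i "\<lambda>k. x $ Inl (k, r)" "\<lambda>k. ?u $ Inl (k, r)" "norm (w - x)"]
        x w(2)[of "mode i" r] dist
      by (simp add: feasible_set_def block_norm_def)
    also have "\<dots> \<le> (8 + 16 * real CARD('i)) * (norm (w - x))\<^sup>2"
      by (intro mult_right_mono) (simp_all add: card_mono)
    finally show ?thesis .
  next
    case (Inr r)
    \<comment> \<open>The weights are not normalized, so here \<open>Dw\<close> is already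
      exact.\<close>
    have "?E $ c = 0"
      by (simp only: Inr vector_minus_component proj_jac_matrix_mult_nth Dw[unfolded vector_minus_component]
          block_normalize_nth diff_self)
    then show ?thesis by simp
  qed
  have "norm ?E \<le> (\<Sum>c\<in>UNIV. \<bar>?E $ c\<bar>)"
    by (rule norm_le_l1_cart)
  also have "\<dots> \<le> (\<Sum>c\<in>(UNIV :: ('i \<times> 'r + 'r) set). (8 + 16 * real CARD('i)) * (norm (w - x))\<^sup>2)"
    by (intro sum_mono comp)
  finally show ?thesis
    by (simp only: sum_constant mult.assoc)
qed

section \<open>Continuity and compactness of the family of admissible matrices\<close>

lemma continuous_on_pos_part [continuous_intros]:
  "continuous_on S f \<Longrightarrow> continuous_on S (\<lambda>x. pos_part (f x))"
  unfolding pos_part_def by (intro continuous_intros)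

lemma continuous_on_block_norm [continuous_intros]:
  "continuous_on S f \<Longrightarrow> continuous_on S (\<lambda>x. block_norm mode (f x) n r)"
  unfolding block_norm_def L2_set_def by (intro continuous_intros)

text \<open>The case distinctions depend on the indices alone, and regularity keeps the denominators
  nonzero, so every entry is continuous.\<close>

lemma continuous_on_proj_jac_matrix:
  assumes "continuous_on S f" "continuous_on S g" "\<And>x. x \<in> S \<Longrightarrow> proj_regular mode (f x)"
  shows "continuous_on S (\<lambda>x. proj_jac_matrix mode (f x) (g x))"
proof -
  have "block_norm mode (pos_part (f x)) n r \<noteq> 0" if "x \<in> S" for x n r
    using assms(3)[OF that] by (metis proj_regular_iff less_irrefl)
  moreover have "continuous_on S (\<lambda>x. if Q then p x else q x)"
    if "continuous_on S p" "continuous_on S q" for Q and p q :: "'a \<Rightarrow> real"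
    using that by (cases Q) auto
  ultimately have "continuous_on S (\<lambda>x. proj_jac_matrix mode (f x) (g x) $ b $ c)" for b c
    using assms(1,2) unfolding proj_jac_matrix_def Let_def
    by (cases b; cases c) (simp_all add: case_prod_unfold continuous_intros)
  then show ?thesis
    by (subst vec_lambda_eta[symmetric], intro continuous_on_vec_lambda,
        subst vec_lambda_eta[symmetric], intro continuous_on_vec_lambda)
qed

text \<open>Each entry is confined independently to \<open>{1}\<close>, \<open>[0, 1]\<close> or
  \<open>{0}\<close>, so the set is a closed box.\<close>

lemma compact_sign_diag: "compact {D. sign_diag w D}"
proof -
  have "{D. sign_diag w D} = cbox (\<chi> c. if 0 < w $ c then 1 else 0) (\<chi> c. if w $ c < 0 then 0 else 1)"
    unfolding set_eq_iff mem_Collect_eq sign_diag_def mem_box_cart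
    by (intro allI arg_cong[where f = All] ext) (auto simp: antisym_conv)
  then show ?thesis by simp
qed

text \<open>Where \<open>x\<close> is positive, so is \<open>w\<close>, and both force the entry 1;
  where \<open>x\<close> vanishes, every value in \<open>[0, 1]\<close> is allowed. Thus one compact
  set contains the diagonals admissible at all nearby points.\<close>

lemma sign_diag_near:
  assumes "\<And>c. 0 \<le> x $ c" "\<And>c. 0 < x $ c \<Longrightarrow> 0 < w $ c" "sign_diag w D"
  shows "sign_diag x D"
  using assms unfolding sign_diag_def by (metis linorder_neqE_linordered_idom not_le order_refl zero_le_one)

section \<open>Local quadratic convergence\<close>

lemma continuous_on_matrix_vector_mult [continuous_intros]:
  fixes f :: "'a::topological_space \<Rightarrow> real ^ 'k ^ 'l"
  shows "continuous_on S f \<Longrightarrow> continuous_on S g \<Longrightarrow> continuous_on S (\<lambda>x. f x *v g x)"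
  unfolding matrix_vector_mult_def by (intro continuous_intros)

lemma continuous_on_matrix_mult [continuous_intros]:
  fixes f :: "'a::topological_space \<Rightarrow> real ^ 'k ^ 'l" and g :: "'a \<Rightarrow> real ^ 'j ^ 'k"
  shows "continuous_on S f \<Longrightarrow> continuous_on S g \<Longrightarrow> continuous_on S (\<lambda>x. f x ** g x)"
  unfolding matrix_matrix_mult_def by (intro continuous_intros)

lemma continuous_on_transpose [continuous_intros]:
  fixes f :: "'a::topological_space \<Rightarrow> real ^ 'k ^ 'l"
  shows "continuous_on S f \<Longrightarrow> continuous_on S (\<lambda>x. transpose (f x))"
  unfolding transpose_def by (intro continuous_intros)

lemma continuous_on_JF: "continuous_on S (JF idx T)"
  using polynomial_jacobian(1)[of "F idx T"] real_polynomial_function_F continuous_on_subset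
  unfolding JF_def[abs_def] by blast

lemma continuous_on_grad_step: "continuous_on S (grad_step idx T \<gamma>)"
proof -
  have "continuous_on S (F idx T)"
    using polynomial_jacobian(3)[of "F idx T"] real_polynomial_function_F continuous_on_subset
    by blast
  then show ?thesis
    unfolding grad_step_def[abs_def] by (intro continuous_intros continuous_on_JF)
qed

lemma residual_eq:
  assumes "proj_regular mode (grad_step idx T \<gamma> x)"
  shows "residual mode idx T \<gamma> x = x - block_normalize mode (pos_part (grad_step idx T \<gamma> x))"
  by (simp add: residual_def closest_point_feasible_set assms)

text \<open>The one-step estimate, with a constant independent of the chosen matrix. Regularity and
  invertibility are exported as well, since they make the next step possible.\<close>

lemma newton_step_quadratic:
  fixes mode :: "'i::finite \<Rightarrow> 'n::finite"
    and idx :: "'m::finite \<Rightarrow> 'n \<Rightarrow> 'i"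
    and xs :: "real ^ ('i \<times> 'r::finite + 'r)"
  assumes \<gamma>: "0 < \<gamma>" and xs: "xs \<in> feasible_set mode" and F: "F idx T xs = 0"
    and inv: "\<forall>H \<in> approx_jac mode idx T \<gamma> xs. invertible H"
  obtains C \<delta> where "0 \<le> C" "0 < \<delta>"
    "\<And>x. x \<in> ball xs \<delta> \<Longrightarrow> proj_regular mode (grad_step idx T \<gamma> x)"
    "\<And>x H. x \<in> ball xs \<delta> \<Longrightarrow> H \<in> approx_jac mode idx T \<gamma> x \<Longrightarrow> invertible H"
    "\<And>x H d. x \<in> ball xs \<delta> \<Longrightarrow> H \<in> approx_jac mode idx T \<gamma> x \<Longrightarrow>
       H *v d = - residual mode idx T \<gamma> x \<Longrightarrow> norm (x + d - xs) \<le> C * (norm (x - xs))\<^sup>2"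
proof -
  define w :: "real ^ ('i \<times> 'r + 'r) \<Rightarrow> real ^ ('i \<times> 'r + 'r)" where "w = grad_step idx T \<gamma>"
  define J :: "real ^ ('i \<times> 'r + 'r) \<Rightarrow> real ^ ('i \<times> 'r + 'r) ^ 'm" where "J = JF idx T"
  define M where "M x = mat 1 - \<gamma> *\<^sub>R (transpose (J x) ** J x)" for x :: "real ^ ('i \<times> 'r + 'r)"
  define S where "S = {D. sign_diag xs D}"
  define P where "P = (\<lambda>(x, D). proj_jac_matrix mode (w x) D)"
  \<comment> \<open>Treating the diagonal as a parameter turns the set-valued Jacobian into one
    continuous function on a ball times the compact set \<open>S\<close>.\<close>
  define H where "H = (\<lambda>(x, D). mat 1 - P (x, D) ** M x)"
  have approx_jac: "approx_jac mode idx T \<gamma> x = {H (x, D) |D. proj_regular mode (w x) \<and> sign_diag (w x) D}" for x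
    by (auto simp: approx_jac_def proj_jac_def H_def P_def M_def w_def J_def)
  have contJ: "continuous_on X J" and contw: "continuous_on X w" for X
    unfolding J_def w_def by (rule continuous_on_JF continuous_on_grad_step)+
  have contM: "continuous_on X M" for X
    unfolding M_def[abs_def] by (intro continuous_intros contJ)
  have nonneg: "0 \<le> xs $ c" for c
    using xs by (simp add: feasible_set_def)
  have pos_xs: "pos_part xs = xs"
    using nonneg by (simp add: pos_part_def vec_eq_iff)
  \<comment> \<open>The gradient step fixes a zero of \<open>F\<close>, so the diagonals admissible
    at \<open>w xs\<close> are exactly those in \<open>S\<close>.\<close>
  have w_xs: "w xs = xs"
    by (simp add: w_def grad_step_def F)

  \<comment> \<open>A neighbourhood with controlled signs, block norms and linearization
    error\<close>
  have ev_pos: "\<forall>\<^sub>F x in nhds xs. \<forall>c. 0 < xs $ c \<longrightarrow> 0 < w x $ c"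
  proof (rule eventually_all_finite)
    fix c
    have "((\<lambda>x. w x $ c) \<longlongrightarrow> w xs $ c) (nhds xs)"
      by (intro tendsto_vec_nth continuous_on_UNIV_tendsto_nhds contw)
    then show "\<forall>\<^sub>F x in nhds xs. 0 < xs $ c \<longrightarrow> 0 < w x $ c"
      using order_tendstoD(1)[of _ "w xs $ c" "nhds xs" 0] by (auto simp: w_xs)
  qed
  have ev_norm: "\<forall>\<^sub>F x in nhds xs. \<forall>n r. 1 / 2 < block_norm mode (pos_part (w x)) n r"
  proof (intro eventually_all_finite)
    fix n r
    have "continuous_on UNIV (\<lambda>x. block_norm mode (pos_part (w x)) n r)"
      by (intro continuous_intros contw)
    then have "((\<lambda>x. block_norm mode (pos_part (w x)) n r) \<longlongrightarrow> block_norm mode (pos_part (w xs)) n r) (nhds xs)"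
      by (rule continuous_on_UNIV_tendsto_nhds)
    then show "\<forall>\<^sub>F x in nhds xs. 1 / 2 < block_norm mode (pos_part (w x)) n r"
      using xs by (intro order_tendstoD(1)) (auto simp: w_xs pos_xs feasible_set_def)
  qed
  obtain Cq where Cq: "0 < Cq"
    and ev_rem: "\<forall>\<^sub>F x in nhds xs. norm (norm (F idx T xs - F idx T x - J x *v (xs - x))) \<le> Cq * norm ((norm (x - xs))\<^sup>2)"
    using polynomial_jacobian(2)[OF real_polynomial_function_F, of idx T xs]
    unfolding J_def JF_def by (elim landau_o.bigE)
  obtain \<rho>' where \<rho>': "0 < \<rho>'" "\<And>x. dist x xs < \<rho>' \<Longrightarrow>
      (\<forall>c. 0 < xs $ c \<longrightarrow> 0 < w x $ c) \<and>
      (\<forall>n r. 1 / 2 < block_norm mode (pos_part (w x)) n r) \<and>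
      norm (norm (F idx T xs - F idx T x - J x *v (xs - x))) \<le> Cq * norm ((norm (x - xs))\<^sup>2)"
    using eventually_conj[OF ev_pos eventually_conj[OF ev_norm ev_rem]]
    unfolding eventually_nhds_metric by blast
  \<comment> \<open>Half the radius puts a closed, hence compact, ball inside the
    neighbourhood.\<close>
  define \<rho> where "\<rho> = \<rho>' / 2"
  have \<rho>: "0 < \<rho>"
    using \<rho>' by (simp add: \<rho>_def)
  have near: "dist x xs < \<rho>'" if "x \<in> cball xs \<rho>" for x
    using that \<rho>'(1) by (simp add: \<rho>_def dist_commute)
  have w_pos: "0 < w x $ c" if "x \<in> cball xs \<rho>" "0 < xs $ c" for x c
    using \<rho>'(2)[OF near[OF that(1)]] that(2) by blast
  have w_norm: "1 / 2 < block_norm mode (pos_part (w x)) n r" if "x \<in> cball xs \<rho>" for x n r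
    using \<rho>'(2)[OF near[OF that]] by blast
  have F_rem: "norm (J x *v (x - xs) - F idx T x) \<le> Cq * (norm (x - xs))\<^sup>2" if "x \<in> cball xs \<rho>" for x
  proof -
    have eq: "J x *v (x - xs) - F idx T x = F idx T xs - F idx T x - J x *v (xs - x)"
      by (simp add: F matrix_vector_mult_diff_distrib)
    then show ?thesis
      unfolding eq using \<rho>'(2)[OF near[OF that]] by simp
  qed
  have regular: "proj_regular mode (w x)" if "x \<in> cball xs \<rho>" for x
    unfolding proj_regular_iff using w_norm[OF that] by (meson half_gt_zero_iff less_trans zero_less_one)

  \<comment> \<open>Uniform constants on this neighbourhood\<close>
  have compS: "compact S"
    unfolding S_def by (rule compact_sign_diag)
  have contP: "continuous_on (cball xs \<rho> \<times> S) P"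
    unfolding P_def case_prod_unfold
    by (intro continuous_on_proj_jac_matrix continuous_on_compose2[OF contw[of UNIV]] continuous_intros)
      (auto intro: regular)
  have contH: "continuous_on (cball xs \<rho> \<times> S) H"
    unfolding H_def case_prod_unfold
    by (simp, intro continuous_intros contP continuous_on_compose2[OF contM[of UNIV]]) auto
  have "invertible (H (xs, D))" if "D \<in> S" for D
    using inv regular[of xs] \<rho> that unfolding approx_jac w_xs S_def by auto
  with uniformly_nonsingular_near[OF \<rho> compS contH] obtain m \<delta> where
    m: "m > 0" "\<And>x D v. x \<in> cball xs \<delta> \<Longrightarrow> D \<in> S \<Longrightarrow> m * norm v \<le> norm (H (x, D) *v v)"
    and \<delta>: "0 < \<delta>" "\<delta> \<le> \<rho>"
    by metis
  obtain BP where BP: "0 < BP" "\<And>q v. q \<in> cball xs \<rho> \<times> S \<Longrightarrow> norm (P q *v v) \<le> BP * norm v"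
    using matrix_vector_mult_uniformly_bounded[OF _ contP] compS compact_Times compact_cball by metis
  obtain BM where BM: "0 < BM" "\<And>x v. x \<in> cball xs \<rho> \<Longrightarrow> norm (M x *v v) \<le> BM * norm v"
    using matrix_vector_mult_uniformly_bounded[OF compact_cball contM] by metis
  obtain BJ where BJ: "0 < BJ" "\<And>x v. x \<in> cball xs \<rho> \<Longrightarrow> norm (transpose (J x) *v v) \<le> BJ * norm v"
    using matrix_vector_mult_uniformly_bounded[OF compact_cball continuous_on_transpose[OF contJ]] by metis
  \<comment> \<open>\<open>K\<close> is the constant of \<open>projection_remainder\<close>, and
    \<open>L\<close> a Lipschitz-type bound for \<open>w x - xs\<close>, with one factor of the
    quadratic term absorbed into \<open>\<rho>\<close>. \<open>C\<close> adds the projection error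
    and the linearization error passed through \<open>P\<close>, and divides by the lower bound
    \<open>m\<close>.\<close>
  define K where "K = real CARD('i \<times> 'r + 'r) * (8 + 16 * real CARD('i))"
  define L where "L = BM + \<gamma> * BJ * Cq * \<rho>"
  define C where "C = (K * L\<^sup>2 + BP * (\<gamma> * BJ * Cq)) / m"

  \<comment> \<open>Both facts about \<open>D\<close> are kept: admissibility at \<open>w x\<close>
    for the projection remainder, membership in \<open>S\<close> for the uniform bounds.\<close>
  have H_cases: "\<exists>D. A = H (x, D) \<and> sign_diag (w x) D \<and> D \<in> S"
    if x: "x \<in> ball xs \<delta>" and A: "A \<in> approx_jac mode idx T \<gamma> x" for x A
  proof -
    obtain D where D: "A = H (x, D)" "sign_diag (w x) D"
      using A unfolding approx_jac by blast
    have "D \<in> S"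
      unfolding S_def mem_Collect_eq
      by (rule sign_diag_near[OF nonneg w_pos D(2)]) (use x \<delta> in auto)
    then show ?thesis
      using D by blast
  qed

  show ?thesis
  proof (rule that[of C \<delta>])
    show "0 \<le> C"
      using m BP BJ Cq \<gamma> by (simp add: C_def K_def)
    show "0 < \<delta>"
      by fact
    show "proj_regular mode (grad_step idx T \<gamma> x)" if "x \<in> ball xs \<delta>" for x
      using regular[of x] that \<delta> by (simp add: w_def)
    show "invertible A" if A: "x \<in> ball xs \<delta>" "A \<in> approx_jac mode idx T \<gamma> x" for x A
    proof -
      obtain D where D: "A = H (x, D)" "D \<in> S"
        using H_cases[OF A] by blast
      have "v = 0" if "A *v v = 0" for v
        using m(2)[of x D v] m(1) A(1) D that by (simp add: mult_le_0_iff)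
      then show ?thesis
        by (simp add: invertible_left_inverse matrix_left_invertible_ker)
    qed
    show "norm (x + d - xs) \<le> C * (norm (x - xs))\<^sup>2"
      if A: "x \<in> ball xs \<delta>" "A \<in> approx_jac mode idx T \<gamma> x" and step: "A *v d = - residual mode idx T \<gamma> x"
      for x A d
    proof -
      obtain D where D: "A = H (x, D)" "sign_diag (w x) D" "D \<in> S"
        using H_cases[OF A] by blast
      define e where "e = x - xs"
      have x: "x \<in> cball xs \<rho>"
        using A(1) \<delta> by simp
      have e\<rho>: "norm e \<le> \<rho>"
        using x by (simp add: e_def dist_norm norm_minus_commute)
      \<comment> \<open>The error of replacing \<open>F idx T x\<close> by \<open>J x *v e\<close>
        in the gradient step; it is of second order by \<open>F_rem\<close>.\<close>
      define q where "q = \<gamma> *\<^sub>R (transpose (J x) *v (J x *v e - F idx T x))"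
      have w_eq: "w x - xs = M x *v e + q"
        by (simp add: w_def grad_step_def M_def q_def e_def matrix_vector_mult_diff_distrib
            matrix_vector_mult_diff_rdistrib scaleR_matrix_vector_assoc[symmetric]
            matrix_vector_mul_assoc[symmetric] J_def algebra_simps)
      have q: "norm q \<le> \<gamma> * BJ * Cq * (norm e)\<^sup>2"
      proof -
        have "norm q \<le> \<gamma> * (BJ * norm (J x *v e - F idx T x))"
          using BJ(2)[OF x] \<gamma> by (simp add: q_def)
        also have "\<dots> \<le> \<gamma> * (BJ * (Cq * (norm e)\<^sup>2))"
          using F_rem[OF x] \<gamma> BJ(1) by (intro mult_left_mono) (auto simp: e_def)
        finally show ?thesis by (simp add: mult_ac)
      qed
      have w_le: "norm (w x - xs) \<le> L * norm e"
      proof -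
        have "norm (w x - xs) \<le> BM * norm e + \<gamma> * BJ * Cq * (norm e)\<^sup>2"
          unfolding w_eq using BM(2)[OF x] q by (rule norm_triangle_mono)
        also have "\<dots> \<le> BM * norm e + \<gamma> * BJ * Cq * (\<rho> * norm e)"
          using e\<rho> \<gamma> BJ(1) Cq unfolding power2_eq_square
          by (intro add_left_mono mult_left_mono mult_right_mono) auto
        finally show ?thesis by (simp add: L_def algebra_simps)
      qed
      let ?b = "block_normalize mode (pos_part (w x)) - xs - P (x, D) *v (w x - xs)"
      have "A *v (x + d - xs) = A *v e + A *v d"
        by (simp add: e_def diff_add_eq flip: matrix_vector_right_distrib)
      also have "A *v e = e - P (x, D) *v (M x *v e)"
        by (simp add: D H_def matrix_vector_mult_diff_rdistrib matrix_vector_mul_assoc)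
      also have "A *v d = block_normalize mode (pos_part (w x)) - x"
        using step regular[OF x] by (simp add: residual_eq w_def)
      \<comment> \<open>The iterate \<open>x\<close> cancels against \<open>e = x - xs\<close>, and
        \<open>M x *v e = (w x - xs) - q\<close> leaves the projection remainder plus the
        transported linearization error.\<close>
      finally have "A *v (x + d - xs) = ?b + P (x, D) *v q"
        by (simp add: w_eq matrix_vector_right_distrib e_def)
      moreover have "norm ?b \<le> K * (L * norm e)\<^sup>2"
      proof -
        have "norm ?b \<le> K * (norm (w x - xs))\<^sup>2"
          unfolding P_def K_def prod.case
          by (rule projection_remainder[OF xs D(2)])
            (use w_pos[OF x] w_norm[OF x] in \<open>auto intro: less_imp_le\<close>)
        also have "\<dots> \<le> K * (L * norm e)\<^sup>2"
          using w_le by (intro mult_left_mono power_mono) (auto simp: K_def)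
        finally show ?thesis .
      qed
      moreover have "norm (P (x, D) *v q) \<le> BP * (\<gamma> * BJ * Cq * (norm e)\<^sup>2)"
        by (rule order_trans[OF BP(2) mult_left_mono[OF q]]) (use x D(3) BP(1) in auto)
      ultimately have "norm (A *v (x + d - xs)) \<le> K * (L * norm e)\<^sup>2 + BP * (\<gamma> * BJ * Cq * (norm e)\<^sup>2)"
        by (metis norm_triangle_mono)
      moreover have "m * norm (x + d - xs) \<le> norm (A *v (x + d - xs))"
        unfolding D(1) using A(1) D(3) by (intro m(2)) auto
      ultimately have "m * norm (x + d - xs) \<le> (K * L\<^sup>2 + BP * (\<gamma> * BJ * Cq)) * (norm e)\<^sup>2"
        by (simp add: algebra_simps)
      then show ?thesis
        using m(1) by (simp add: C_def e_def field_simps)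
    qed
  qed
qed

text \<open>On a small ball the quadratic estimate also halves the error, so iterates never leave
  the ball. Regularity makes the set of admissible matrices nonempty and invertibility makes each
  linear system solvable; hence every finite run can be continued.\<close>

theorem theorem1:
  fixes mode :: "'i::finite \<Rightarrow> 'n::finite"
    and idx :: "'m::finite \<Rightarrow> 'n \<Rightarrow> 'i"
    and T :: "real ^ 'm"
    and \<gamma> :: real
    and xstar :: "real ^ ('i \<times> 'r::finite + 'r)"
  assumes "tensor_shape mode idx"
    and "\<gamma> > 0"
    and "xstar \<in> feasible_set mode"
    and "F idx T xstar = 0"
    and "\<forall>H \<in> approx_jac mode idx T \<gamma> xstar. invertible H"
  shows "\<exists>\<epsilon>>0. \<forall>x0 \<in> ball xstar \<epsilon>.
    \<comment> \<open>the iteration never breaks down, whatever matrices have been chosen before\<close>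
    (\<forall>x d H K. x 0 = x0 \<and> (\<forall>k<K. newton_step mode idx T \<gamma> x d H k) \<longrightarrow>
        proj_regular mode (grad_step idx T \<gamma> (x K)) \<and>
        (\<forall>H' \<in> approx_jac mode idx T \<gamma> (x K). invertible H')) \<and>
    (\<forall>x d H. x 0 = x0 \<and> (\<forall>k. newton_step mode idx T \<gamma> x d H k) \<longrightarrow>
        q_quadratically_convergent x xstar)"
proof -
  obtain C \<delta> where C: "0 \<le> C" and \<delta>: "0 < \<delta>"
    and reg: "\<And>x. x \<in> ball xstar \<delta> \<Longrightarrow> proj_regular mode (grad_step idx T \<gamma> x)"
    and nonsing: "\<And>x H. x \<in> ball xstar \<delta> \<Longrightarrow> H \<in> approx_jac mode idx T \<gamma> x \<Longrightarrow> invertible H"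
    and quad: "\<And>x H d. x \<in> ball xstar \<delta> \<Longrightarrow> H \<in> approx_jac mode idx T \<gamma> x \<Longrightarrow>
      H *v d = - residual mode idx T \<gamma> x \<Longrightarrow> norm (x + d - xstar) \<le> C * (norm (x - xstar))\<^sup>2"
    using newton_step_quadratic[OF assms(2-5)] by metis
  \<comment> \<open>Chosen so that \<open>C * \<epsilon> \<le> 1 / 2\<close>; adding 1 avoids a zero
    denominator when \<open>C = 0\<close>.\<close>
  define \<epsilon> where "\<epsilon> = min \<delta> (1 / (2 * (C + 1)))"
  have \<epsilon>: "0 < \<epsilon>" "\<epsilon> \<le> \<delta>" "C * \<epsilon> \<le> 1 / 2"
  proof -
    have "C * \<epsilon> \<le> C * (1 / (2 * (C + 1)))"
      using C by (intro mult_left_mono) (auto simp: \<epsilon>_def)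
    also have "\<dots> \<le> 1 / 2"
      using C by (simp add: field_simps)
    finally show "C * \<epsilon> \<le> 1 / 2" .
  qed (use C \<delta> in \<open>auto simp: \<epsilon>_def\<close>)
  have step: "norm (x (Suc k) - xstar) \<le> C * (norm (x k - xstar))\<^sup>2 \<and>
      norm (x (Suc k) - xstar) \<le> norm (x k - xstar) / 2"
    if "newton_step mode idx T \<gamma> x d H k" "norm (x k - xstar) < \<epsilon>" for x d H k
  proof -
    have 1: "norm (x (Suc k) - xstar) \<le> C * (norm (x k - xstar))\<^sup>2"
      using that \<epsilon> quad[of "x k" "H k" "d k"]
      by (simp add: newton_step_def dist_norm norm_minus_commute)
    also have "\<dots> \<le> C * \<epsilon> * norm (x k - xstar)"
      using that(2) C by (simp add: power2_eq_square mult.assoc mult_left_mono mult_right_mono)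
    also have "\<dots> \<le> 1 / 2 * norm (x k - xstar)"
      using \<epsilon>(3) by (rule mult_right_mono) simp
    finally show ?thesis using 1 by simp
  qed
  \<comment> \<open>Only the steps before \<open>k\<close> are assumed to be Newton steps, so the
    bound serves finite runs as well as infinite ones.\<close>
  have linear: "norm (x k - xstar) \<le> norm (x 0 - xstar) * (1 / 2) ^ k"
    if "norm (x 0 - xstar) < \<epsilon>" "\<forall>j<k. newton_step mode idx T \<gamma> x d H j" for x d H k
    using that(2)
  proof (induction k)
    case (Suc k)
    then have IH: "norm (x k - xstar) \<le> norm (x 0 - xstar) * (1 / 2) ^ k"
      by simp
    also have "\<dots> \<le> norm (x 0 - xstar)"
      by (simp add: mult_left_le power_le_one)
    finally have "norm (x k - xstar) < \<epsilon>"
      using that(1) by simp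
    then show ?case
      using step[of x d H k] Suc.prems IH by simp
  qed simp
  have stays: "norm (x k - xstar) < \<epsilon>"
    if "norm (x 0 - xstar) < \<epsilon>" "\<forall>j<k. newton_step mode idx T \<gamma> x d H j" for x d H k
  proof -
    have "norm (x 0 - xstar) * (1 / 2) ^ k \<le> norm (x 0 - xstar)"
      by (simp add: mult_left_le power_le_one)
    then show ?thesis
      using linear[of x k d H, OF that] that(1) by simp
  qed
  have "q_quadratically_convergent x xstar"
    if x0: "norm (x 0 - xstar) < \<epsilon>" and newton: "\<forall>k. newton_step mode idx T \<gamma> x d H k" for x d H
    unfolding q_quadratically_convergent_def
  proof
    have "(\<lambda>k. norm (x 0 - xstar) * (1 / 2) ^ k) \<longlonglongrightarrow> 0"
      by (intro tendsto_mult_right_zero LIMSEQ_power_zero) simp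
    then have "(\<lambda>k. x k - xstar) \<longlonglongrightarrow> 0"
      by (rule Lim_null_comparison[rotated]) (use linear[of x _ d H, OF x0] newton in auto)
    then show "x \<longlonglongrightarrow> xstar"
      by (rule LIM_zero_cancel)
    have "norm (x (Suc k) - xstar) \<le> C * (norm (x k - xstar))\<^sup>2" for k
      using step[of x d H k] stays[of x k d H, OF x0] newton by blast
    then show "\<exists>c\<ge>0. \<forall>\<^sub>F k in sequentially. norm (x (Suc k) - xstar) \<le> c * (norm (x k - xstar))\<^sup>2"
      using C by (intro exI[of _ C]) simp
  qed
  moreover have "proj_regular mode (grad_step idx T \<gamma> (x K)) \<and>
      (\<forall>H' \<in> approx_jac mode idx T \<gamma> (x K). invertible H')"
    if "norm (x 0 - xstar) < \<epsilon>" "\<forall>k<K. newton_step mode idx T \<gamma> x d H k" for x d H K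
  proof -
    have "x K \<in> ball xstar \<delta>"
      using stays[of x K d H, OF that] \<epsilon>(2) by (simp add: dist_norm norm_minus_commute)
    then show ?thesis
      using reg nonsing by blast
  qed
  ultimately show ?thesis
    using \<epsilon>(1) by (intro exI[of _ \<epsilon>]) (auto simp: dist_norm norm_minus_commute)
qed

end
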